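(* (ZF, without any form of the axiom of choice.) Suppose that $2^\omega$ is the countable union of countable sets. Then there exists an $F_{\sigma\delta}$ set $B\subseteq 2^\omega$ which is uncountable but contains no perfect subset.
   Context: The background theory is ZF; no form of choice is assumed, not even the countable axiom of choice (so a countable union of countable sets need not be countable). A set is countable if it is empty or the image of a map with domain $\omega$, and uncountable otherwise. $2^\omega$ carries its usual topology, with basic clopen sets $[s]=\{x\in 2^\omega : s\subseteq x\}$ for $s\in 2^{<\omega}$. Closed sets are complements of open sets; $F_\sigma$ sets are unions of countable families of closed sets; $F_{\sigma\delta}$ sets are intersections of countable families of $F_\sigma$ sets. A subset $P\subseteq 2^\omega$ is perfect iff it is homeomorphic to $2^\omega$. *)

theory Defs
  imports Main
begin

text \<open>
  Theorems of ZF are rendered as truths in every first-order model \<open>(UNIV :: 'a set, mem)\<close>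
  of ZF.  HOL's own choice principle does not leak into such a model, because the schemas of
  Separation and Replacement are only assumed for first-order formulas (with parameters), not
  for arbitrary HOL predicates.

  Consequently every set-theoretic notion below is internal to the model: all quantifiers range
  over elements of the model, and \<open>\<omega>\<close>, functions, countability and the topology of the Cantor
  space \<open>2\<^sup>\<omega>\<close> are those of the model, not those of HOL.  Each definition is literally a
  first-order formula over \<open>mem\<close>; a predicate \<open>is_c x \<dots>\<close> says that \<open>x\<close> is the set \<open>c(\<dots>)\<close>.
\<close>

text \<open>First-order formulas of the language of set theory, with variables named by numbers.\<close>

datatype fm =
    Mem nat nat
  | Equal nat nat
  | Neg fm
  | Conj fm fm
  | Forall nat fm

locale set_structure =
  fixes mem :: "'a \<Rightarrow> 'a \<Rightarrow> bool"  (infix "\<^bold>\<in>" 50)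
begin

primrec sat :: "fm \<Rightarrow> (nat \<Rightarrow> 'a) \<Rightarrow> bool" where
  "sat (Mem i j) e \<longleftrightarrow> e i \<^bold>\<in> e j"
| "sat (Equal i j) e \<longleftrightarrow> e i = e j"
| "sat (Neg p) e \<longleftrightarrow> \<not> sat p e"
| "sat (Conj p q) e \<longleftrightarrow> sat p e \<and> sat q e"
| "sat (Forall i p) e \<longleftrightarrow> (\<forall>x. sat p (e(i := x)))"

definition subset :: "'a \<Rightarrow> 'a \<Rightarrow> bool"  (infix "\<^bold>\<subseteq>" 50) where
  "A \<^bold>\<subseteq> B \<longleftrightarrow> (\<forall>x. x \<^bold>\<in> A \<longrightarrow> x \<^bold>\<in> B)"

definition is_empty :: "'a \<Rightarrow> bool" where
  "is_empty z \<longleftrightarrow> (\<forall>x. \<not> x \<^bold>\<in> z)"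

definition is_upair :: "'a \<Rightarrow> 'a \<Rightarrow> 'a \<Rightarrow> bool" where
  "is_upair c a b \<longleftrightarrow> (\<forall>x. x \<^bold>\<in> c \<longleftrightarrow> x = a \<or> x = b)"

definition is_Union :: "'a \<Rightarrow> 'a \<Rightarrow> bool" where
  "is_Union U F \<longleftrightarrow> (\<forall>x. x \<^bold>\<in> U \<longleftrightarrow> (\<exists>A. A \<^bold>\<in> F \<and> x \<^bold>\<in> A))"

definition is_succ :: "'a \<Rightarrow> 'a \<Rightarrow> bool" where
  "is_succ s n \<longleftrightarrow> (\<forall>x. x \<^bold>\<in> s \<longleftrightarrow> x \<^bold>\<in> n \<or> x = n)"

definition is_inductive :: "'a \<Rightarrow> bool" where
  "is_inductive I \<longleftrightarrow>
     (\<exists>z. is_empty z \<and> z \<^bold>\<in> I) \<and> (\<forall>n. n \<^bold>\<in> I \<longrightarrow> (\<exists>s. is_succ s n \<and> s \<^bold>\<in> I))"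

definition is_omega :: "'a \<Rightarrow> bool" where
  "is_omega w \<longleftrightarrow> is_inductive w \<and> (\<forall>I. is_inductive I \<longrightarrow> w \<^bold>\<subseteq> I)"

definition is_two :: "'a \<Rightarrow> bool" where
  "is_two t \<longleftrightarrow> (\<exists>z u. is_empty z \<and> is_succ u z \<and> is_succ t u)"

text \<open>Kuratowski pairs; a function is the set of its argument-value pairs.\<close>

definition is_pair :: "'a \<Rightarrow> 'a \<Rightarrow> 'a \<Rightarrow> bool" where
  "is_pair p a b \<longleftrightarrow> (\<exists>c d. is_upair c a a \<and> is_upair d a b \<and> is_upair p c d)"

definition maps_to :: "'a \<Rightarrow> 'a \<Rightarrow> 'a \<Rightarrow> bool" where
  "maps_to f a b \<longleftrightarrow> (\<exists>p. is_pair p a b \<and> p \<^bold>\<in> f)"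

definition is_fun :: "'a \<Rightarrow> 'a \<Rightarrow> 'a \<Rightarrow> bool" where
  "is_fun f A B \<longleftrightarrow>
     (\<forall>p. p \<^bold>\<in> f \<longrightarrow> (\<exists>a b. a \<^bold>\<in> A \<and> b \<^bold>\<in> B \<and> is_pair p a b)) \<and>
     (\<forall>a. a \<^bold>\<in> A \<longrightarrow> (\<exists>!b. maps_to f a b))"

definition is_countable :: "'a \<Rightarrow> bool" where
  "is_countable A \<longleftrightarrow>
     is_empty A \<or>
     (\<exists>w f. is_omega w \<and> is_fun f w A \<and> (\<forall>a. a \<^bold>\<in> A \<longrightarrow> (\<exists>n. n \<^bold>\<in> w \<and> maps_to f n a)))"

text \<open>The points of \<open>2\<^sup>\<omega>\<close>, the set \<open>2\<^sup>\<omega>\<close>, and the finite 0-1 sequences.\<close>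

definition cantor_point :: "'a \<Rightarrow> bool" where
  "cantor_point x \<longleftrightarrow> (\<exists>w t. is_omega w \<and> is_two t \<and> is_fun x w t)"

definition is_cantor :: "'a \<Rightarrow> bool" where
  "is_cantor K \<longleftrightarrow> (\<forall>x. x \<^bold>\<in> K \<longleftrightarrow> cantor_point x)"

definition fin_seq :: "'a \<Rightarrow> bool" where
  "fin_seq s \<longleftrightarrow> (\<exists>w n t. is_omega w \<and> n \<^bold>\<in> w \<and> is_two t \<and> is_fun s n t)"

definition is_cylinder :: "'a \<Rightarrow> 'a \<Rightarrow> bool" where
  "is_cylinder N s \<longleftrightarrow> (\<forall>x. x \<^bold>\<in> N \<longleftrightarrow> cantor_point x \<and> s \<^bold>\<subseteq> x)"

definition open_set :: "'a \<Rightarrow> bool" where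
  "open_set U \<longleftrightarrow>
     (\<exists>F. (\<forall>N. N \<^bold>\<in> F \<longrightarrow> (\<exists>s. fin_seq s \<and> is_cylinder N s)) \<and> is_Union U F)"

definition closed_set :: "'a \<Rightarrow> bool" where
  "closed_set C \<longleftrightarrow> (\<exists>U. open_set U \<and> (\<forall>x. x \<^bold>\<in> C \<longleftrightarrow> cantor_point x \<and> \<not> x \<^bold>\<in> U))"

definition F_sigma :: "'a \<Rightarrow> bool" where
  "F_sigma A \<longleftrightarrow>
     (\<exists>F. is_countable F \<and> (\<forall>C. C \<^bold>\<in> F \<longrightarrow> closed_set C) \<and> is_Union A F)"

text \<open>The intersection is taken inside \<open>2\<^sup>\<omega>\<close>, so the empty family gives \<open>2\<^sup>\<omega>\<close>.\<close>

definition F_sigma_delta :: "'a \<Rightarrow> bool" where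
  "F_sigma_delta B \<longleftrightarrow>
     (\<exists>F. is_countable F \<and> (\<forall>A. A \<^bold>\<in> F \<longrightarrow> F_sigma A) \<and>
          (\<forall>x. x \<^bold>\<in> B \<longleftrightarrow> cantor_point x \<and> (\<forall>A. A \<^bold>\<in> F \<longrightarrow> x \<^bold>\<in> A)))"

text \<open>Subsets of \<open>2\<^sup>\<omega>\<close> carry the subspace topology.\<close>

definition rel_open :: "'a \<Rightarrow> 'a \<Rightarrow> bool" where
  "rel_open V P \<longleftrightarrow> (\<exists>U. open_set U \<and> (\<forall>x. x \<^bold>\<in> V \<longleftrightarrow> x \<^bold>\<in> U \<and> x \<^bold>\<in> P))"

definition is_continuous :: "'a \<Rightarrow> 'a \<Rightarrow> 'a \<Rightarrow> bool" where
  "is_continuous f P Q \<longleftrightarrow>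
     is_fun f P Q \<and>
     (\<forall>V. rel_open V Q \<longrightarrow>
        (\<exists>U. rel_open U P \<and> (\<forall>x. x \<^bold>\<in> U \<longleftrightarrow> x \<^bold>\<in> P \<and> (\<exists>y. y \<^bold>\<in> V \<and> maps_to f x y))))"

definition homeomorphic_sets :: "'a \<Rightarrow> 'a \<Rightarrow> bool" where
  "homeomorphic_sets P Q \<longleftrightarrow>
     (\<exists>f g. is_continuous f P Q \<and> is_continuous g Q P \<and>
            (\<forall>x y. maps_to f x y \<longleftrightarrow> maps_to g y x))"

definition perfect_set :: "'a \<Rightarrow> bool" where
  "perfect_set P \<longleftrightarrow> (\<exists>K. is_cantor K \<and> P \<^bold>\<subseteq> K \<and> homeomorphic_sets P K)"

end

text \<open>
  In the two schemas, variable 0 (and 1) of \<open>p\<close> is the argument (and the value); the other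
  variables are parameters, interpreted by the arbitrary assignment \<open>e\<close>.
\<close>

locale ZF_model = set_structure +
  assumes extensionality: "(\<forall>x. x \<^bold>\<in> A \<longleftrightarrow> x \<^bold>\<in> B) \<Longrightarrow> A = B"
    and foundation: "\<exists>x. x \<^bold>\<in> A \<Longrightarrow> \<exists>x. x \<^bold>\<in> A \<and> \<not> (\<exists>y. y \<^bold>\<in> x \<and> y \<^bold>\<in> A)"
    and pairing: "\<exists>c. is_upair c a b"
    and union: "\<exists>U. is_Union U F"
    and powerset: "\<exists>P. \<forall>X. X \<^bold>\<in> P \<longleftrightarrow> X \<^bold>\<subseteq> A"
    and infinity: "\<exists>I. is_inductive I"
    and separation: "\<exists>B. \<forall>x. x \<^bold>\<in> B \<longleftrightarrow> x \<^bold>\<in> A \<and> sat p (e(0 := x))"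
    and replacement:
      "(\<forall>x. x \<^bold>\<in> A \<longrightarrow> (\<forall>y z. sat p (e(0 := x, 1 := y)) \<and> sat p (e(0 := x, 1 := z)) \<longrightarrow> y = z))
       \<Longrightarrow> \<exists>B. \<forall>y. y \<^bold>\<in> B \<longleftrightarrow> (\<exists>x. x \<^bold>\<in> A \<and> sat p (e(0 := x, 1 := y)))"

end

theory Submission
  imports Defs
begin

text \<open>
  Let \<open>2\<^sup>\<omega>\<close> be the union of the countable sets \<open>F\<^sub>n\<close>, let \<open>B\<close> consist of the zero sequence and of
  all sequences \<open>0\<^sup>n 1 z\<close> with \<open>z \<in> F\<^sub>n\<close>.  It is the intersection of the sets
  \<open>A\<^sub>n = {x. if x begins with 0\<^sup>n 1, then its remainder is in F\<^sub>n}\<close>, and \<open>A\<^sub>n\<close> is the union over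
  \<open>z \<in> F\<^sub>n\<close> of the closed sets of all \<open>x\<close> which have remainder \<open>z\<close> if they begin with \<open>0\<^sup>n 1\<close>
  (for empty \<open>F\<^sub>n\<close>, the set \<open>A\<^sub>n\<close> is itself closed).
  Every sequence is a remainder of a point of \<open>B\<close>, so if \<open>B\<close> were countable, \<open>2\<^sup>\<omega>\<close> would be.
  A perfect subset of \<open>B\<close> has a nonzero point, so it meets the cylinder of some \<open>0\<^sup>n 1\<close> in a
  nonempty relatively open set.  This set is countable, as it is embedded into \<open>F\<^sub>n\<close>, but it contains
  a homeomorphic copy of a cylinder of \<open>2\<^sup>\<omega>\<close>, which is uncountable.
\<close>

section \<open>First-order definability\<close>

primrec ren :: "(nat \<Rightarrow> nat) \<Rightarrow> fm \<Rightarrow> fm" where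
  "ren f (Mem i j) = Mem (f i) (f j)"
| "ren f (Equal i j) = Equal (f i) (f j)"
| "ren f (Neg p) = Neg (ren f p)"
| "ren f (Conj p q) = Conj (ren f p) (ren f q)"
| "ren f (Forall i p) = Forall (f i) (ren f p)"

primrec var_bound :: "fm \<Rightarrow> nat" where
  "var_bound (Mem i j) = Suc (max i j)"
| "var_bound (Equal i j) = Suc (max i j)"
| "var_bound (Neg p) = var_bound p"
| "var_bound (Conj p q) = max (var_bound p) (var_bound q)"
| "var_bound (Forall i p) = max (Suc i) (var_bound p)"

definition interleave :: "(nat \<Rightarrow> 'b) \<Rightarrow> (nat \<Rightarrow> 'b) \<Rightarrow> nat \<Rightarrow> 'b" where
  "interleave e r n = (if even n then e (n div 2) else r (n div 2))"

lemma interleave_simps [simp]: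
  "interleave e r (2 * n) = e n" "interleave e r (Suc (2 * n)) = r n" "interleave e r 0 = e 0"
  by (auto simp: interleave_def)

lemma interleave_upd: "(interleave e r)(2 * k := x) = interleave (e(k := x)) r"
  by (auto simp: interleave_def fun_eq_iff)

text \<open>Renames the environment variables (even) by \<open>f\<close> and the parameter variables
  (odd) by \<open>g\<close>, keeping the two kinds apart.\<close>

definition split_map :: "(nat \<Rightarrow> nat) \<Rightarrow> (nat \<Rightarrow> nat) \<Rightarrow> nat \<Rightarrow> nat" where
  "split_map f g = interleave (\<lambda>n. 2 * f n) (\<lambda>n. Suc (2 * g n))"

lemma interleave_split_map:
  "interleave e r (split_map f g n) = interleave (\<lambda>n. e (f n)) (\<lambda>n. r (g n)) n"
  by (simp add: split_map_def interleave_def)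

lemma inj_split_map:
  assumes "inj f" "inj g"
  shows "inj (split_map f g)"
proof (rule injI)
  fix m n assume eq: "split_map f g m = split_map f g n"
  have "even (split_map f g i) \<longleftrightarrow> even i" for i
    by (simp add: split_map_def interleave_def)
  then have parity: "even m = even n" using eq by metis
  then have "m div 2 = n div 2"
    using eq by (auto simp: split_map_def interleave_def inj_eq assms split: if_splits)
  then show "m = n" using parity by (metis div_mult_mod_eq parity_cases)
qed

context set_structure
begin

text \<open>Injectivity prevents capture: updating at \<open>f i\<close> affects only those renamed
  variables that come from \<open>i\<close>.\<close>

lemma sat_ren: "inj f \<Longrightarrow> sat (ren f p) e \<longleftrightarrow> sat p (\<lambda>n. e (f n))"
proof (induction p arbitrary: e)
  case (Forall i p)
  have "(\<lambda>n. (e(f i := x)) (f n)) = (\<lambda>n. e (f n))(i := x)" for x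
    using Forall.prems by (auto simp: fun_eq_iff inj_def)
  then show ?case using Forall by simp
qed auto

lemma sat_cong: "(\<And>n. n < var_bound p \<Longrightarrow> e n = e' n) \<Longrightarrow> sat p e \<longleftrightarrow> sat p e'"
proof (induction p arbitrary: e e')
  case (Forall i p)
  have "sat p (e(i := x)) \<longleftrightarrow> sat p (e'(i := x))" for x
    by (rule Forall.IH) (use Forall.prems in auto)
  then show ?case by simp
next
  case (Conj p q)
  have "sat p e \<longleftrightarrow> sat p e'" by (rule Conj.IH) (use Conj.prems in auto)
  moreover have "sat q e \<longleftrightarrow> sat q e'" by (rule Conj.IH) (use Conj.prems in auto)
  ultimately show ?case by simp
next
  case (Neg p)
  have "sat p e \<longleftrightarrow> sat p e'" by (rule Neg.IH) (use Neg.prems in auto)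
  then show ?case by simp
next
  case (Mem i j)
  then show ?case using Mem[of i] Mem[of j] by simp
next
  case (Equal i j)
  then show ?case using Equal[of i] Equal[of j] by simp
qed

text \<open>
  A predicate of environments is definable if some formula expresses it when the environment is
  stored in the even variables and fixed parameters in the odd ones.  Under a binder environments
  are shifted in the style of de Bruijn: the bound variable is \<open>e 0\<close>.
\<close>

definition definable :: "((nat \<Rightarrow> 'a) \<Rightarrow> bool) \<Rightarrow> bool" where
  "definable P \<longleftrightarrow> (\<exists>p r. \<forall>e. P e \<longleftrightarrow> sat p (interleave e r))"

text \<open>A term is treated through its graph: slot 0 carries the value, and the environment of
  the term starts at slot 1.\<close>

definition definable_term :: "((nat \<Rightarrow> 'a) \<Rightarrow> 'a) \<Rightarrow> bool" where
  "definable_term t \<longleftrightarrow> definable (\<lambda>e. e 0 = t (\<lambda>n. e (Suc n)))"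

lemma sat_ren_split_map:
  assumes "inj f" "inj g"
  shows "sat (ren (split_map f g) p) (interleave e r) \<longleftrightarrow>
    sat p (interleave (\<lambda>n. e (f n)) (\<lambda>n. r (g n)))"
  by (simp only: sat_ren[OF inj_split_map[OF assms]] interleave_split_map)

lemma definable_rename:
  assumes "definable P" "inj f"
  shows "definable (\<lambda>e. P (\<lambda>n. e (f n)))"
proof -
  obtain p r where p: "\<And>e. P e \<longleftrightarrow> sat p (interleave e r)"
    using assms(1) unfolding definable_def by blast
  have "P (\<lambda>n. e (f n)) \<longleftrightarrow> sat (ren (split_map f id) p) (interleave e r)" for e
    by (simp add: sat_ren_split_map assms(2) p)
  then show ?thesis unfolding definable_def by blast
qed

section \<open>Definability of atoms and closure under connectives, quantifiers and
  substitution\<close>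

lemma definable_atom_mem: "definable (\<lambda>e. e i \<^bold>\<in> e j)"
  unfolding definable_def by (rule exI[of _ "Mem (2 * i) (2 * j)"]) simp

lemma definable_atom_eq: "definable (\<lambda>e. e i = e j)"
  unfolding definable_def by (rule exI[of _ "Equal (2 * i) (2 * j)"]) simp

lemma definable_atom_const: "definable (\<lambda>e. e i = c)"
  unfolding definable_def
  \<comment> \<open>The constant becomes a parameter, stored in the odd variables.\<close>
  by (rule exI[of _ "Equal (2 * i) (Suc (2 * 0))"], rule exI[of _ "\<lambda>_. c"])
     (simp only: sat.simps interleave_simps simp_thms)

lemma definable_not:
  assumes "definable P"
  shows "definable (\<lambda>e. \<not> P e)"
proof -
  obtain p r where "\<And>e. P e \<longleftrightarrow> sat p (interleave e r)" using assms unfolding definable_def by blast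
  then have "\<forall>e. \<not> P e \<longleftrightarrow> sat (Neg p) (interleave e r)" by simp
  then show ?thesis unfolding definable_def by blast
qed

lemma definable_conj:
  assumes "definable P" "definable Q"
  shows "definable (\<lambda>e. P e \<and> Q e)"
proof -
  obtain p r where p: "\<And>e. P e \<longleftrightarrow> sat p (interleave e r)" using assms(1) unfolding definable_def by blast
  obtain q s where q: "\<And>e. Q e \<longleftrightarrow> sat q (interleave e s)" using assms(2) unfolding definable_def by blast
  \<comment> \<open>The two parameter sequences are merged into one; \<open>?f\<close> and
    \<open>?g\<close> redirect the parameters of \<open>p\<close> and \<open>q\<close> to their
    halves of it.\<close>
  let ?s = "interleave r s" and ?f = "split_map id (\<lambda>n. 2 * n)" and ?g = "split_map id (\<lambda>n. Suc (2 * n))"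
  have "P e \<and> Q e \<longleftrightarrow> sat (Conj (ren ?f p) (ren ?g q)) (interleave e ?s)" for e
    by (simp add: sat_ren_split_map inj_def p q)
  then show ?thesis unfolding definable_def by blast
qed

lemma definable_all:
  assumes "definable (\<lambda>e. Q (e 0) (\<lambda>n. e (Suc n)))"
  shows "definable (\<lambda>e. \<forall>x. Q x e)"
proof -
  obtain p r where p: "\<And>e. Q (e 0) (\<lambda>n. e (Suc n)) \<longleftrightarrow> sat p (interleave e r)"
    using assms unfolding definable_def by blast
  define k where "k = var_bound p"
  \<comment> \<open>The bound variable moves from slot 0 to the slot \<open>k\<close> beyond the
    reach of \<open>p\<close>, and the slots \<open>1..k\<close> move down by one. Slots above
    \<open>k\<close> stay fixed, which keeps \<open>f\<close> injective and is invisible to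
    \<open>p\<close>.\<close>
  define f where "f n = (case n of 0 \<Rightarrow> k | Suc i \<Rightarrow> if i < k then i else Suc i)" for n
  have f: "inj f"
    by (auto simp: inj_def f_def split: nat.splits if_splits)
  have "Q x e \<longleftrightarrow> sat (ren (split_map f id) p) ((interleave e r)(2 * k := x))" for x e
  proof -
    have "interleave (\<lambda>n. (e(k := x)) (f n)) r n = interleave (case_nat x e) r n" if "n < k" for n
      using that by (auto simp: interleave_def f_def split: nat.splits)
    then have "sat p (interleave (\<lambda>n. (e(k := x)) (f n)) r) \<longleftrightarrow> sat p (interleave (case_nat x e) r)"
      unfolding k_def by (rule sat_cong)
    then show ?thesis
      using p[of "case_nat x e"] by (simp add: interleave_upd sat_ren_split_map[OF f])
  qed
  then have "(\<forall>x. Q x e) \<longleftrightarrow> sat (Forall (2 * k) (ren (split_map f id) p)) (interleave e r)" for e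
    by simp
  then show ?thesis unfolding definable_def by blast
qed

lemma definable_disj:
  assumes "definable P" "definable Q"
  shows "definable (\<lambda>e. P e \<or> Q e)"
  using definable_not[OF definable_conj[OF assms[THEN definable_not]]] by simp

lemma definable_imp:
  assumes "definable P" "definable Q"
  shows "definable (\<lambda>e. P e \<longrightarrow> Q e)"
  using definable_disj[OF definable_not[OF assms(1)] assms(2)] by simp

lemma definable_iff:
  assumes "definable P" "definable Q"
  shows "definable (\<lambda>e. P e \<longleftrightarrow> Q e)"
  using definable_conj[OF definable_imp[OF assms] definable_imp[OF assms(2,1)]]
  unfolding iff_conv_conj_imp .

lemma definable_ex:
  "definable (\<lambda>e. Q (e 0) (\<lambda>n. e (Suc n))) \<Longrightarrow> definable (\<lambda>e. \<exists>x. Q x e)"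
  using definable_not[OF definable_all[of "\<lambda>x e. \<not> Q x e", OF definable_not]] by simp

lemma definable_subst:
  assumes "definable_term t" "definable (\<lambda>e. Q (e 0) (\<lambda>n. e (Suc n)))"
  shows "definable (\<lambda>e. Q (t e) e)"
proof -
  have "definable (\<lambda>e. \<exists>x. x = t e \<and> Q x e)"
    by (rule definable_ex, rule definable_conj[OF assms(1)[unfolded definable_term_def] assms(2)])
  then show ?thesis by simp
qed

lemma definable_term_var: "definable_term (\<lambda>e. e i)"
  unfolding definable_term_def by (rule definable_atom_eq)

lemma definable_term_const: "definable_term (\<lambda>e. c)"
  unfolding definable_term_def by (rule definable_atom_const)

lemma definable_term_shift: "definable_term t \<Longrightarrow> definable_term (\<lambda>e. t (\<lambda>n. e (Suc n)))"
  using definable_rename[of "\<lambda>e. e 0 = t (\<lambda>n. e (Suc n))" "\<lambda>n. case n of 0 \<Rightarrow> 0 | Suc n \<Rightarrow> Suc (Suc n)"]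
  unfolding definable_term_def by (auto simp: inj_def split: nat.splits)

lemma definable_subst2:
  assumes "definable_term t" "definable_term u" "definable (\<lambda>e. R (e 1) (e 0))"
  shows "definable (\<lambda>e. R (t e) (u e))"
proof (rule definable_subst[OF assms(1)], rule definable_subst[OF definable_term_shift[OF assms(2)]])
  show "definable (\<lambda>e. R (e (Suc 0)) (e 0))" using assms(3) by simp
qed

lemma definable_mem:
  "definable_term t \<Longrightarrow> definable_term u \<Longrightarrow> definable (\<lambda>e. t e \<^bold>\<in> u e)"
  by (rule definable_subst2[where R = "\<lambda>x y. x \<^bold>\<in> y", OF _ _ definable_atom_mem])

lemma definable_eq:
  "definable_term t \<Longrightarrow> definable_term u \<Longrightarrow> definable (\<lambda>e. t e = u e)"
  by (rule definable_subst2[where R = "\<lambda>x y. x = y", OF _ _ definable_atom_eq])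

end

section \<open>Sets, numbers and functions of the model\<close>

named_theorems definable_intros

section \<open>Definite descriptions, comprehension and images as definable terms\<close>

context set_structure
begin

lemmas [definable_intros] = definable_mem definable_eq definable_not definable_conj definable_disj
  definable_imp definable_iff definable_all definable_ex definable_term_var definable_term_const

text \<open>
  Unlike HOL's \<open>THE\<close>, \<open>the_set\<close> has the same value for every predicate that is not satisfied
  uniquely; this makes it definable.
\<close>

definition the_set :: "('a \<Rightarrow> bool) \<Rightarrow> 'a" where
  "the_set P = (if \<exists>!x. P x then THE x. P x else (THE z. is_empty z))"

definition compr :: "'a \<Rightarrow> ('a \<Rightarrow> bool) \<Rightarrow> 'a" where
  "compr A P = the_set (\<lambda>B. \<forall>x. x \<^bold>\<in> B \<longleftrightarrow> x \<^bold>\<in> A \<and> P x)"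

definition img :: "'a \<Rightarrow> ('a \<Rightarrow> 'a) \<Rightarrow> 'a" where
  "img A G = the_set (\<lambda>B. \<forall>y. y \<^bold>\<in> B \<longleftrightarrow> (\<exists>x. x \<^bold>\<in> A \<and> y = G x))"

lemma the_set_equality: "P a \<Longrightarrow> (\<And>x. P x \<Longrightarrow> x = a) \<Longrightarrow> the_set P = a"
  unfolding the_set_def by (metis the_equality)

text \<open>Rewrites the description as a first-order condition; the default value is one fixed
  element and enters as a parameter.\<close>

lemma eq_the_set_iff:
  "y = the_set P \<longleftrightarrow>
     P y \<and> (\<forall>z. P z \<longrightarrow> z = y) \<or> \<not> (\<exists>x. P x \<and> (\<forall>z. P z \<longrightarrow> z = x)) \<and> y = (THE z. is_empty z)"
proof (cases "\<exists>!x. P x")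
  case True
  then obtain a where a: "P a" "\<And>x. P x \<Longrightarrow> x = a" by blast
  then have "the_set P = a" by (rule the_set_equality)
  then show ?thesis using a by metis
next
  case False
  then have "\<not> (\<exists>x. P x \<and> (\<forall>z. P z \<longrightarrow> z = x))" by blast
  then show ?thesis unfolding the_set_def if_not_P[OF False] by blast
qed

text \<open>This lemma and the next insert one or two bound variables between the argument and the
  environment, as required where \<open>P\<close> occurs under the quantifiers of
  \<open>eq_the_set_iff\<close>.\<close>

lemma definable_weaken1:
  assumes "definable (\<lambda>e. P (e 0) (\<lambda>n. e (Suc n)))"
  shows "definable (\<lambda>e. P (e 0) (\<lambda>n. e (Suc (Suc n))))"
  using definable_rename[OF assms, of "\<lambda>n. case n of 0 \<Rightarrow> 0 | Suc n \<Rightarrow> Suc (Suc n)"]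
  by (auto simp: inj_def split: nat.splits)

lemma definable_weaken2:
  assumes "definable (\<lambda>e. P (e 0) (\<lambda>n. e (Suc n)))"
  shows "definable (\<lambda>e. P (e 0) (\<lambda>n. e (Suc (Suc (Suc n)))))"
  using definable_rename[OF assms, of "\<lambda>n. case n of 0 \<Rightarrow> 0 | Suc n \<Rightarrow> Suc (Suc (Suc n))"]
  by (auto simp: inj_def split: nat.splits)

lemma definable_the_set [definable_intros]:
  assumes "definable (\<lambda>e. P (e 0) (\<lambda>n. e (Suc n)))"
  shows "definable_term (\<lambda>e. the_set (\<lambda>x. P x e))"
  unfolding definable_term_def eq_the_set_iff
  by (intro definable_intros assms definable_weaken1[OF assms] definable_weaken2[OF assms])

lemma definable_compr [definable_intros]:
  assumes "definable_term t" "definable (\<lambda>e. P (e 0) (\<lambda>n. e (Suc n)))"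
  shows "definable_term (\<lambda>e. compr (t e) (\<lambda>x. P x e))"
  unfolding compr_def
  by (intro definable_intros definable_weaken1[OF assms(2)] definable_term_shift assms(1))

lemma definable_img [definable_intros]:
  assumes "definable_term t" "definable_term (\<lambda>e. G (e 0) (\<lambda>n. e (Suc n)))"
  shows "definable_term (\<lambda>e. img (t e) (\<lambda>x. G x e))"
proof -
  have "definable (\<lambda>e. e 0 = G (e 1) (\<lambda>n. e (Suc (Suc n))))"
    using assms(2) unfolding definable_term_def by simp
  \<comment> \<open>Value and argument trade places because \<open>img\<close> binds the element
    \<open>y\<close> outside the preimage \<open>x\<close>; slot 2 is left for the image set
    \<open>B\<close>.\<close>
  from definable_rename[OF this, of "\<lambda>n. case n of 0 \<Rightarrow> 1 | Suc 0 \<Rightarrow> 0 | Suc (Suc n) \<Rightarrow> Suc (Suc (Suc n))"]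
  have "definable (\<lambda>e. e (Suc 0) = G (e 0) (\<lambda>n. e (Suc (Suc (Suc n)))))"
    by (auto simp: inj_def split: nat.splits)
  then show ?thesis
    unfolding img_def
    by (intro definable_the_set definable_all definable_iff definable_ex definable_conj definable_mem
        definable_term_var definable_term_shift assms(1))
qed

lemma definable_if [definable_intros]:
  assumes "definable P" "definable_term t" "definable_term u"
  shows "definable_term (\<lambda>e. if P e then t e else u e)"
proof -
  have "y = (if Q then a else b) \<longleftrightarrow> Q \<and> y = a \<or> \<not> Q \<and> y = b" for y a b :: 'a and Q by simp
  moreover have "definable (\<lambda>e. P (\<lambda>n. e (Suc n)))"
    using definable_rename[OF assms(1), of Suc] by simp
  ultimately show ?thesis
    unfolding definable_term_def by (simp only:)
      (intro definable_intros definable_term_shift assms(2,3))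
qed

end

context ZF_model
begin

section \<open>Separation and Replacement for definable predicates and terms\<close>

lemma set_eqI: "(\<And>x. x \<^bold>\<in> A \<longleftrightarrow> x \<^bold>\<in> B) \<Longrightarrow> A = B"
  using extensionality by blast

lemma mem_the_set:
  "\<exists>B. \<forall>x. x \<^bold>\<in> B \<longleftrightarrow> P x \<Longrightarrow> x \<^bold>\<in> the_set (\<lambda>B. \<forall>x. x \<^bold>\<in> B \<longleftrightarrow> P x) \<longleftrightarrow> P x"
proof -
  assume "\<exists>B. \<forall>x. x \<^bold>\<in> B \<longleftrightarrow> P x"
  then obtain B where B: "\<forall>x. x \<^bold>\<in> B \<longleftrightarrow> P x" by blast
  have "the_set (\<lambda>B. \<forall>x. x \<^bold>\<in> B \<longleftrightarrow> P x) = B"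
  proof (rule the_set_equality)
    show "\<forall>x. x \<^bold>\<in> B \<longleftrightarrow> P x" by (rule B)
    show "C = B" if "\<forall>x. x \<^bold>\<in> C \<longleftrightarrow> P x" for C
      by (rule set_eqI) (use B that in blast)
  qed
  then show ?thesis using B by simp
qed

lemma mem_compr:
  assumes "definable (\<lambda>e. P (e 0))"
  shows "x \<^bold>\<in> compr A P \<longleftrightarrow> x \<^bold>\<in> A \<and> P x"
  unfolding compr_def
proof (rule mem_the_set)
  obtain p r where p: "\<And>e. P (e 0) \<longleftrightarrow> sat p (interleave e r)"
    using assms unfolding definable_def by blast
  \<comment> \<open>\<open>P\<close> looks at slot 0 alone, so any filler serves for the other
    environment slots.\<close>
  have "P x \<longleftrightarrow> sat p ((interleave undefined r)(0 := x))" for x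
    using p[of "undefined(0 := x)"] interleave_upd[of undefined r 0 x] by simp
  then show "\<exists>B. \<forall>x. x \<^bold>\<in> B \<longleftrightarrow> x \<^bold>\<in> A \<and> P x"
    using separation[of A p] by simp
qed

lemma mem_img:
  assumes "definable_term (\<lambda>e. G (e 0))"
  shows "y \<^bold>\<in> img A G \<longleftrightarrow> (\<exists>x. x \<^bold>\<in> A \<and> y = G x)"
  unfolding img_def
proof (rule mem_the_set)
  obtain p r where p: "\<And>e. e 0 = G (e (Suc 0)) \<longleftrightarrow> sat p (interleave e r)"
    using assms unfolding definable_term_def definable_def by blast
  \<comment> \<open>In \<open>p\<close>, variable 0 is the value, 2 the argument and 1 the first
    parameter. Replacement expects the argument at 0 and the value at 1, so that parameter moves to
    2. Accordingly \<open>?e\<close> yields \<open>r m\<close> at \<open>2 * m + 1\<close>, and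
    \<open>r 0\<close> at 2.\<close>
  let ?f = "\<lambda>n::nat. if n = 0 then 1 else if n = 2 then 0 else if n = 1 then 2 else n"
  let ?e = "\<lambda>n. r ((n - 1) div 2)"
  have f: "inj ?f" by (auto simp: inj_def)
  have eq: "sat (ren ?f p) (?e(0 := x, 1 := y)) \<longleftrightarrow> y = G x" for x y
  proof -
    have "(?e(0 := x, 1 := y)) (?f n) = interleave (\<lambda>n. if n = 0 then y else if n = 1 then x else ?e (2 * n)) r n"
      for n
      by (auto simp: interleave_def elim!: oddE evenE)
    then show ?thesis
      using p[of "\<lambda>n. if n = 0 then y else if n = 1 then x else ?e (2 * n)"] by (simp add: sat_ren[OF f])
  qed
  then show "\<exists>B. \<forall>y. y \<^bold>\<in> B \<longleftrightarrow> (\<exists>x. x \<^bold>\<in> A \<and> y = G x)"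
    using replacement[of A "ren ?f p" ?e] unfolding eq by blast
qed

section \<open>Empty set, pairs and successors\<close>

definition emp :: 'a where "emp = the_set is_empty"
definition upair :: "'a \<Rightarrow> 'a \<Rightarrow> 'a" where "upair a b = the_set (\<lambda>c. is_upair c a b)"
definition suc :: "'a \<Rightarrow> 'a" where "suc n = the_set (\<lambda>s. is_succ s n)"
definition pair :: "'a \<Rightarrow> 'a \<Rightarrow> 'a" where "pair a b = upair (upair a a) (upair a b)"
definition om :: 'a where "om = the_set is_omega"
definition one :: 'a where "one = suc emp"
definition two :: 'a where "two = suc one"
definition app :: "'a \<Rightarrow> 'a \<Rightarrow> 'a" where "app f a = the_set (\<lambda>b. pair a b \<^bold>\<in> f)"
definition lam :: "'a \<Rightarrow> ('a \<Rightarrow> 'a) \<Rightarrow> 'a" where "lam A G = img A (\<lambda>a. pair a (G a))"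

lemma definable_upair [definable_intros]:
  "definable_term t \<Longrightarrow> definable_term u \<Longrightarrow> definable_term (\<lambda>e. upair (t e) (u e))"
  unfolding upair_def is_upair_def by (intro definable_intros definable_term_shift)

lemma definable_suc [definable_intros]:
  "definable_term t \<Longrightarrow> definable_term (\<lambda>e. suc (t e))"
  unfolding suc_def is_succ_def by (intro definable_intros definable_term_shift)

lemma definable_pair [definable_intros]:
  "definable_term t \<Longrightarrow> definable_term u \<Longrightarrow> definable_term (\<lambda>e. pair (t e) (u e))"
  unfolding pair_def by (intro definable_intros)

lemma definable_app [definable_intros]:
  "definable_term t \<Longrightarrow> definable_term u \<Longrightarrow> definable_term (\<lambda>e. app (t e) (u e))"
  unfolding app_def by (intro definable_intros definable_term_shift)

lemma definable_lam [definable_intros]: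
  assumes "definable_term t" "definable_term (\<lambda>e. G (e 0) (\<lambda>n. e (Suc n)))"
  shows "definable_term (\<lambda>e. lam (t e) (\<lambda>x. G x e))"
  unfolding lam_def by (intro definable_intros assms)

lemma mem_the_set':
  assumes "\<exists>B. \<forall>x. x \<^bold>\<in> B \<longleftrightarrow> P x"
  shows "(\<forall>x. x \<^bold>\<in> B \<longleftrightarrow> P x) \<longleftrightarrow> B = the_set (\<lambda>B. \<forall>x. x \<^bold>\<in> B \<longleftrightarrow> P x)"
  using mem_the_set[OF assms] set_eqI by blast

lemma is_empty_iff: "is_empty z \<longleftrightarrow> z = emp"
proof -
  have ex: "\<exists>z. \<forall>x. x \<^bold>\<in> z \<longleftrightarrow> False"
    using infinity unfolding is_inductive_def is_empty_def by blast
  have eq: "is_empty = (\<lambda>z. \<forall>x. x \<^bold>\<in> z \<longleftrightarrow> False)"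
    by (simp add: fun_eq_iff is_empty_def)
  show ?thesis unfolding emp_def eq by (rule mem_the_set'[OF ex])
qed

lemma not_mem_emp [simp]: "\<not> x \<^bold>\<in> emp"
  using is_empty_iff unfolding is_empty_def by blast

lemma is_upair_iff: "is_upair c a b \<longleftrightarrow> c = upair a b"
  using mem_the_set'[OF pairing[of a b, unfolded is_upair_def]] unfolding upair_def is_upair_def .

lemma mem_upair: "x \<^bold>\<in> upair a b \<longleftrightarrow> x = a \<or> x = b"
  using is_upair_iff unfolding is_upair_def by blast

lemma is_succ_iff: "is_succ s n \<longleftrightarrow> s = suc n"
proof -
  obtain U where U: "is_Union U (upair n (upair n n))" using union by blast
  have "\<exists>s. \<forall>x. x \<^bold>\<in> s \<longleftrightarrow> x \<^bold>\<in> n \<or> x = n"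
    using U unfolding is_Union_def mem_upair by (metis mem_upair)
  from mem_the_set'[OF this] show ?thesis unfolding suc_def is_succ_def .
qed

lemma mem_suc [simp]: "x \<^bold>\<in> suc n \<longleftrightarrow> x \<^bold>\<in> n \<or> x = n"
  using is_succ_iff unfolding is_succ_def by blast

lemma is_pair_iff: "is_pair p a b \<longleftrightarrow> p = pair a b"
  unfolding is_pair_def is_upair_iff pair_def by blast

lemma pair_inject [simp]: "pair a b = pair c d \<longleftrightarrow> a = c \<and> b = d"
  unfolding pair_def by (metis mem_upair)

lemma not_mem_self: "\<not> x \<^bold>\<in> x"
  using foundation[of "upair x x"] unfolding mem_upair by blast

lemma mem_asym: "x \<^bold>\<in> y \<Longrightarrow> \<not> y \<^bold>\<in> x"
  using foundation[of "upair x y"] unfolding mem_upair by blast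

lemma suc_inject [simp]: "suc m = suc n \<longleftrightarrow> m = n"
  by (metis mem_suc mem_asym)

lemma suc_neq_emp [simp]: "suc n \<noteq> emp"
  by (metis mem_suc not_mem_emp)

section \<open>The natural numbers of the model and their order\<close>

lemma is_inductive_iff: "is_inductive I \<longleftrightarrow> emp \<^bold>\<in> I \<and> (\<forall>n. n \<^bold>\<in> I \<longrightarrow> suc n \<^bold>\<in> I)"
  unfolding is_inductive_def is_empty_iff is_succ_iff by blast

lemma is_omega_om: "is_omega om"
proof -
  obtain I where I: "is_inductive I" using infinity by blast
  \<comment> \<open>The intersection of all inductive sets, cut out of \<open>I\<close>. The
    quantifier over \<open>J\<close> ranges over the model, so the condition is first-order.\<close>
  let ?P = "\<lambda>x. \<forall>J. emp \<^bold>\<in> J \<and> (\<forall>n. n \<^bold>\<in> J \<longrightarrow> suc n \<^bold>\<in> J) \<longrightarrow> x \<^bold>\<in> J"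
  have P: "x \<^bold>\<in> compr I ?P \<longleftrightarrow> x \<^bold>\<in> I \<and> ?P x" for x
    by (rule mem_compr) (intro definable_intros)
  have "is_inductive (compr I ?P)"
    using I unfolding is_inductive_iff P by meson
  then have omega: "is_omega (compr I ?P)"
    unfolding is_omega_def subset_def P by (auto simp: is_inductive_iff)
  have unique: "w = compr I ?P" if "is_omega w" for w
    using that omega unfolding is_omega_def subset_def by (intro set_eqI) blast
  show ?thesis
    using the_set_equality[of is_omega, OF omega unique] omega unfolding om_def by simp
qed

lemma is_omega_iff: "is_omega w \<longleftrightarrow> w = om"
proof
  assume "is_omega w"
  then show "w = om" using is_omega_om unfolding is_omega_def subset_def by (intro set_eqI) blast
qed (simp add: is_omega_om)

lemma emp_om [simp]: "emp \<^bold>\<in> om" and suc_om [simp]: "n \<^bold>\<in> om \<Longrightarrow> suc n \<^bold>\<in> om"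
  using is_omega_om unfolding is_omega_def is_inductive_iff by blast+

text \<open>Separation turns a definable \<open>P\<close> into an inductive subset of
  \<open>om\<close>. The case \<open>definable\<close> keeps arbitrary HOL predicates out: the model
  may have nonstandard numbers.\<close>

lemma om_induct [consumes 1, case_names definable zero suc]:
  assumes "n \<^bold>\<in> om" "definable (\<lambda>e. P (e 0))" "P emp" "\<And>n. n \<^bold>\<in> om \<Longrightarrow> P n \<Longrightarrow> P (suc n)"
  shows "P n"
proof -
  have "is_inductive (compr om P)"
    using assms(3,4) unfolding is_inductive_iff mem_compr[OF assms(2)] by simp
  then show ?thesis
    using assms(1) is_omega_om unfolding is_omega_def subset_def by (metis mem_compr[OF assms(2)])
qed

lemma om_cases:
  assumes "n \<^bold>\<in> om"
  obtains "n = emp" | m where "m \<^bold>\<in> om" "n = suc m"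
proof -
  have "n = emp \<or> (\<exists>m. m \<^bold>\<in> om \<and> n = suc m)"
    using assms by (induction n rule: om_induct) (intro definable_intros, auto)
  then show ?thesis using that by blast
qed

lemma mem_om_trans:
  assumes "n \<^bold>\<in> om" "k \<^bold>\<in> n"
  shows "k \<^bold>\<in> om"
proof -
  have "\<forall>k. k \<^bold>\<in> n \<longrightarrow> k \<^bold>\<in> om"
    using assms(1) by (induction n rule: om_induct) (intro definable_intros, auto)
  then show ?thesis using assms(2) by blast
qed

lemma om_mem_trans:
  assumes "n \<^bold>\<in> om" "j \<^bold>\<in> n" "i \<^bold>\<in> j"
  shows "i \<^bold>\<in> n"
proof -
  have "\<forall>j. j \<^bold>\<in> n \<longrightarrow> (\<forall>i. i \<^bold>\<in> j \<longrightarrow> i \<^bold>\<in> n)"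
    using assms(1) by (induction n rule: om_induct) (intro definable_intros, auto)
  then show ?thesis using assms(2,3) by blast
qed

lemma emp_mem: "n \<^bold>\<in> om \<Longrightarrow> n = emp \<or> emp \<^bold>\<in> n"
  by (induction n rule: om_induct) (intro definable_intros, auto)

lemma suc_mem:
  assumes "n \<^bold>\<in> om" "k \<^bold>\<in> n"
  shows "suc k \<^bold>\<in> n \<or> suc k = n"
proof -
  have "\<forall>k. k \<^bold>\<in> n \<longrightarrow> suc k \<^bold>\<in> n \<or> suc k = n"
    using assms(1) by (induction n rule: om_induct) (intro definable_intros, auto)
  then show ?thesis using assms(2) by blast
qed

lemma om_linear:
  assumes "m \<^bold>\<in> om" "n \<^bold>\<in> om"
  shows "m \<^bold>\<in> n \<or> m = n \<or> n \<^bold>\<in> m"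
  using assms(1)
proof (induction m rule: om_induct)
  case definable
  show ?case by (intro definable_intros)
next
  case zero
  show ?case using emp_mem[OF assms(2)] by auto
next
  case (suc m)
  then show ?case using suc_mem[OF assms(2), of m] by auto
qed

lemma is_two_iff: "is_two t \<longleftrightarrow> t = two"
  unfolding is_two_def is_empty_iff is_succ_iff two_def one_def by blast

lemma mem_two: "x \<^bold>\<in> two \<longleftrightarrow> x = emp \<or> x = one"
  unfolding two_def one_def by simp

lemma one_neq_emp [simp]: "one \<noteq> emp" "emp \<noteq> one"
  using suc_neq_emp unfolding one_def by metis+

section \<open>Functions as sets of pairs\<close>

lemma maps_to_iff: "maps_to f a b \<longleftrightarrow> pair a b \<^bold>\<in> f"
  unfolding maps_to_def is_pair_iff by blast

lemma is_fun_iff: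
  "is_fun f A B \<longleftrightarrow>
     (\<forall>p. p \<^bold>\<in> f \<longrightarrow> (\<exists>a b. a \<^bold>\<in> A \<and> b \<^bold>\<in> B \<and> p = pair a b)) \<and>
     (\<forall>a. a \<^bold>\<in> A \<longrightarrow> (\<exists>!b. pair a b \<^bold>\<in> f))"
  unfolding is_fun_def maps_to_iff is_pair_iff ..

lemma definable_is_fun [definable_intros]:
  "definable_term t \<Longrightarrow> definable_term u \<Longrightarrow> definable_term v \<Longrightarrow>
    definable (\<lambda>e. is_fun (t e) (u e) (v e))"
  unfolding is_fun_iff Ex1_def by (intro definable_intros definable_term_shift)

lemma pair_mem_fun:
  assumes "is_fun f A B"
  shows "pair a b \<^bold>\<in> f \<longleftrightarrow> a \<^bold>\<in> A \<and> b = app f a"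
proof -
  have "app f a = c" if "pair a c \<^bold>\<in> f" for c
  proof -
    have "a \<^bold>\<in> A" using assms that unfolding is_fun_iff by auto
    then have "\<exists>!b. pair a b \<^bold>\<in> f" using assms unfolding is_fun_iff by blast
    then show ?thesis unfolding app_def by (intro the_set_equality) (use that in blast)+
  qed
  moreover have "\<exists>c. pair a c \<^bold>\<in> f" if "a \<^bold>\<in> A"
    using assms that unfolding is_fun_iff by blast
  moreover have "a \<^bold>\<in> A" if "pair a b \<^bold>\<in> f"
    using assms that unfolding is_fun_iff by auto
  ultimately show ?thesis by metis
qed

lemma app_mem: "is_fun f A B \<Longrightarrow> a \<^bold>\<in> A \<Longrightarrow> app f a \<^bold>\<in> B"
  using pair_mem_fun[of f A B a "app f a"] unfolding is_fun_iff by auto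

lemma fun_eqI:
  assumes "is_fun f A B" "is_fun g A B" "\<And>a. a \<^bold>\<in> A \<Longrightarrow> app f a = app g a"
  shows "f = g"
proof (rule set_eqI)
  fix p
  show "p \<^bold>\<in> f \<longleftrightarrow> p \<^bold>\<in> g"
    using assms pair_mem_fun[OF assms(1)] pair_mem_fun[OF assms(2)] unfolding is_fun_iff by metis
qed

lemma
  assumes "definable_term (\<lambda>e. G (e 0))" "\<And>a. a \<^bold>\<in> A \<Longrightarrow> G a \<^bold>\<in> B"
  shows is_fun_lam: "is_fun (lam A G) A B"
    and app_lam: "a \<^bold>\<in> A \<Longrightarrow> app (lam A G) a = G a"
proof -
  have "definable_term (\<lambda>e. pair (e 0) (G (e 0)))"
    by (intro definable_intros assms(1))
  note mem = mem_img[OF this, of _ A, folded lam_def]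
  show "is_fun (lam A G) A B" unfolding is_fun_iff mem using assms(2) by auto
  then show "a \<^bold>\<in> A \<Longrightarrow> app (lam A G) a = G a" using pair_mem_fun mem by metis
qed

text \<open>
  Addition on \<open>\<omega>\<close> without a recursion theorem: the map \<open>k \<mapsto> n + k\<close> is shown to exist by internal
  induction on \<open>n\<close>, and to be unique by induction on \<open>k\<close>.
\<close>

definition is_shift :: "'a \<Rightarrow> 'a \<Rightarrow> bool" where
  "is_shift h n \<longleftrightarrow> is_fun h om om \<and> app h emp = n \<and> (\<forall>k. k \<^bold>\<in> om \<longrightarrow> app h (suc k) = suc (app h k))"

definition add :: "'a \<Rightarrow> 'a \<Rightarrow> 'a" where
  "add n k = app (the_set (\<lambda>h. is_shift h n)) k"

lemma definable_is_shift [definable_intros]: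
  "definable_term t \<Longrightarrow> definable_term u \<Longrightarrow> definable (\<lambda>e. is_shift (t e) (u e))"
  unfolding is_shift_def by (intro definable_intros definable_term_shift)

lemma definable_add [definable_intros]:
  "definable_term t \<Longrightarrow> definable_term u \<Longrightarrow> definable_term (\<lambda>e. add (t e) (u e))"
  unfolding add_def by (intro definable_intros definable_term_shift)

lemma is_shift_unique:
  assumes "is_shift h n" "is_shift h' n"
  shows "h = h'"
proof (rule fun_eqI)
  show "is_fun h om om" "is_fun h' om om" using assms unfolding is_shift_def by auto
  show "app h k = app h' k" if "k \<^bold>\<in> om" for k
    using that
  proof (induction k rule: om_induct)
    case definable
    show ?case by (intro definable_intros)
  qed (use assms in \<open>auto simp: is_shift_def\<close>)
qed

lemma is_shift_exists: "n \<^bold>\<in> om \<Longrightarrow> \<exists>h. is_shift h n"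
proof (induction n rule: om_induct)
  case definable
  show ?case by (intro definable_intros)
next
  case zero
  have "definable_term (\<lambda>e. e 0)" by (intro definable_intros)
  then have "is_shift (lam om (\<lambda>k. k)) emp"
    unfolding is_shift_def by (simp add: is_fun_lam app_lam[where B = om])
  then show ?case by blast
next
  case (suc n)
  then obtain h where h: "is_fun h om om" "app h emp = n"
    "\<And>k. k \<^bold>\<in> om \<Longrightarrow> app h (suc k) = suc (app h k)"
    unfolding is_shift_def by blast
  have d: "definable_term (\<lambda>e. suc (app h (e 0)))" by (intro definable_intros)
  have "is_shift (lam om (\<lambda>k. suc (app h k))) (suc n)"
    unfolding is_shift_def using h app_mem[OF h(1)]
    by (simp add: is_fun_lam[OF d] app_lam[OF d, where B = om])
  then show ?case by blast
qed

lemma is_shift_the: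
  assumes "n \<^bold>\<in> om"
  shows "is_shift (the_set (\<lambda>h. is_shift h n)) n"
proof -
  obtain h where h: "is_shift h n" using is_shift_exists[OF assms] by blast
  have "the_set (\<lambda>h. is_shift h n) = h"
    by (rule the_set_equality[of "\<lambda>h. is_shift h n", OF h]) (rule is_shift_unique[OF _ h])
  then show ?thesis using h by simp
qed

context
  fixes n assumes n: "n \<^bold>\<in> om"
begin

lemma add_emp: "add n emp = n"
  and add_suc: "k \<^bold>\<in> om \<Longrightarrow> add n (suc k) = suc (add n k)"
  and add_om: "k \<^bold>\<in> om \<Longrightarrow> add n k \<^bold>\<in> om"
  using is_shift_the[OF n] app_mem unfolding is_shift_def add_def by auto

lemma mem_add: "k \<^bold>\<in> om \<Longrightarrow> add n k = n \<or> n \<^bold>\<in> add n k"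
  by (induction k rule: om_induct) (intro definable_intros, auto simp: add_emp add_suc)

lemma not_add_mem: "k \<^bold>\<in> om \<Longrightarrow> \<not> add n k \<^bold>\<in> n"
  using mem_add mem_asym not_mem_self by metis

lemma mem_add_trans: "k \<^bold>\<in> om \<Longrightarrow> j \<^bold>\<in> n \<Longrightarrow> j \<^bold>\<in> add n k"
  using mem_add om_mem_trans add_om by metis

lemma add_suc_neq: "k \<^bold>\<in> om \<Longrightarrow> add n (suc k) \<noteq> n"
  using mem_add add_suc not_mem_self mem_suc by metis

lemma add_inject:
  assumes "k \<^bold>\<in> om" "l \<^bold>\<in> om" "add n k = add n l"
  shows "k = l"
proof -
  \<comment> \<open>\<open>l\<close> is quantified inside the formula because the successor step
    uses the hypothesis at the predecessor of \<open>l\<close>.\<close>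
  have "\<forall>l. l \<^bold>\<in> om \<and> add n k = add n l \<longrightarrow> k = l"
    using assms(1)
  proof (induction k rule: om_induct)
    case definable
    show ?case by (intro definable_intros)
  next
    case zero
    show ?case using add_emp add_suc_neq om_cases by metis
  next
    case (suc k)
    show ?case
    proof (intro allI impI)
      fix l assume l: "l \<^bold>\<in> om \<and> add n (suc k) = add n l"
      then obtain j where j: "j \<^bold>\<in> om" "l = suc j"
        using om_cases[of l] add_emp add_suc_neq[OF suc(1)] by metis
      then have "add n k = add n j" using l suc(1) by (simp add: add_suc)
      then show "suc k = l" using suc(2) j by simp
    qed
  qed
  then show ?thesis using assms by blast
qed

text \<open>Splits the positions of a sequence into a head below \<open>n\<close> and a tail;
  \<open>tail_inject\<close> and \<open>join\<close> rest on this.\<close>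

lemma less_or_add: "m \<^bold>\<in> om \<Longrightarrow> m \<^bold>\<in> n \<or> (\<exists>k. k \<^bold>\<in> om \<and> m = add n k)"
proof (induction m rule: om_induct)
  case definable
  show ?case by (intro definable_intros)
next
  case zero
  show ?case using emp_mem[OF n] add_emp emp_om by metis
next
  case (suc m)
  then show ?case using suc_mem[OF n] add_emp add_suc emp_om suc_om by metis
qed

end

section \<open>Countability\<close>

lemma is_countable_iff:
  "is_countable A \<longleftrightarrow>
     A = emp \<or> (\<exists>f. is_fun f om A \<and> (\<forall>a. a \<^bold>\<in> A \<longrightarrow> (\<exists>n. n \<^bold>\<in> om \<and> a = app f n)))"
proof -
  have "is_fun f om A \<Longrightarrow> n \<^bold>\<in> om \<and> maps_to f n a \<longleftrightarrow> n \<^bold>\<in> om \<and> a = app f n" for f n a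
    using pair_mem_fun[of f om A n a] unfolding maps_to_iff by blast
  then show ?thesis
    unfolding is_countable_def is_empty_iff is_omega_iff by (metis (no_types, lifting))
qed

text \<open>\<open>G\<close> may take values outside \<open>A\<close>: these are replaced by a fixed
  member \<open>b\<close>, which exists unless \<open>A\<close> is empty.\<close>

lemma countableI:
  assumes "definable_term (\<lambda>e. G (e 0))" "\<And>a. a \<^bold>\<in> A \<Longrightarrow> \<exists>n. n \<^bold>\<in> om \<and> a = G n"
  shows "is_countable A"
proof (cases "\<exists>a. a \<^bold>\<in> A")
  case True
  then obtain b where b: "b \<^bold>\<in> A" by blast
  let ?H = "\<lambda>n. if G n \<^bold>\<in> A then G n else b"
  have d: "definable_term (\<lambda>e. ?H (e 0))" by (intro definable_intros assms(1))
  have H: "?H n \<^bold>\<in> A" for n using b by simp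
  have "\<exists>n. n \<^bold>\<in> om \<and> a = app (lam om ?H) n" if a: "a \<^bold>\<in> A" for a
  proof -
    obtain n where "n \<^bold>\<in> om" "a = G n" using assms(2)[OF a] by blast
    then show ?thesis using app_lam[OF d H, of n om] a by auto
  qed
  then show ?thesis using is_fun_lam[OF d H, of om] unfolding is_countable_iff by blast
next
  case False
  then have "A = emp" by (intro set_eqI) simp
  then show ?thesis unfolding is_countable_iff by blast
qed

lemma definable_term_comp:
  assumes "definable_term t" "definable_term (\<lambda>e. G (e 0))"
  shows "definable_term (\<lambda>e. G (t e))"
proof -
  have "definable (\<lambda>e. e 0 = G (e 1))"
    using assms(2) unfolding definable_term_def by simp
  from definable_rename[OF this, of "\<lambda>n. if n = 0 then 1 else if n = 1 then 0 else n"]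
  have "definable (\<lambda>e. e 1 = G (e 0))" by (simp add: inj_def)
  then show ?thesis
    unfolding definable_term_def[of "\<lambda>e. G (t e)"]
    by (rule definable_subst2[where R = "\<lambda>x y. x = G y", OF definable_term_var definable_term_shift[OF assms(1)]])
qed

text \<open>Compose an enumeration of \<open>C\<close> with \<open>G\<close>. The image of
  \<open>C\<close> may exceed \<open>A\<close>, so subsets of images are covered as well.\<close>

lemma countable_image:
  assumes "is_countable C" "definable_term (\<lambda>e. G (e 0))" "\<And>a. a \<^bold>\<in> A \<Longrightarrow> \<exists>c. c \<^bold>\<in> C \<and> a = G c"
  shows "is_countable A"
proof -
  obtain f where f: "\<And>c. c \<^bold>\<in> C \<Longrightarrow> \<exists>n. n \<^bold>\<in> om \<and> c = app f n"
    using assms(1) not_mem_emp unfolding is_countable_iff by metis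
  have "definable_term (\<lambda>e. G (app f (e 0)))"
    by (intro definable_term_comp[OF _ assms(2)] definable_intros)
  then show ?thesis
    by (rule countableI) (use assms(3) f in blast)
qed

section \<open>The Cantor space\<close>

text \<open>Abbreviations rather than definitions, so that \<open>definable_intros\<close> works
  directly on their bodies.\<close>

abbreviation point :: "'a \<Rightarrow> bool" where "point x \<equiv> is_fun x om two"

abbreviation agree :: "'a \<Rightarrow> 'a \<Rightarrow> 'a \<Rightarrow> bool" where
  "agree n x y \<equiv> \<forall>k. k \<^bold>\<in> n \<longrightarrow> app x k = app y k"

abbreviation tail :: "'a \<Rightarrow> 'a \<Rightarrow> 'a" where
  "tail n x \<equiv> lam om (\<lambda>k. app x (add n k))"

text \<open>The first \<open>n\<close> values of \<open>s\<close> followed by all of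
  \<open>z\<close>: at position \<open>add n k\<close> the description recovers
  \<open>k\<close>.\<close>

abbreviation join :: "'a \<Rightarrow> 'a \<Rightarrow> 'a \<Rightarrow> 'a" where
  "join n s z \<equiv>
     lam om (\<lambda>m. if m \<^bold>\<in> n then app s m else app z (the_set (\<lambda>k. k \<^bold>\<in> om \<and> m = add n k)))"

text \<open>The condition that \<open>x\<close> begins with \<open>0^n 1\<close>.\<close>

abbreviation lead :: "'a \<Rightarrow> 'a \<Rightarrow> bool" where
  "lead n x \<equiv> app x n = one \<and> (\<forall>k. k \<^bold>\<in> n \<longrightarrow> app x k = emp)"

lemma cantor_point_iff: "cantor_point x \<longleftrightarrow> point x"
  unfolding cantor_point_def is_omega_iff is_two_iff by blast

lemma point_cases: "point x \<Longrightarrow> k \<^bold>\<in> om \<Longrightarrow> app x k = emp \<or> app x k = one"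
  using app_mem mem_two by blast

context
  fixes n assumes n: "n \<^bold>\<in> om"
begin

lemma
  assumes x: "point x"
  shows point_tail: "point (tail n x)"
    and app_tail: "k \<^bold>\<in> om \<Longrightarrow> app (tail n x) k = app x (add n k)"
proof -
  have d: "definable_term (\<lambda>e. app x (add n (e 0)))" by (intro definable_intros)
  have "app x (add n k) \<^bold>\<in> two" if "k \<^bold>\<in> om" for k
    using app_mem[OF x add_om[OF n that]] .
  from is_fun_lam[OF d this] app_lam[OF d this]
  show "point (tail n x)" "k \<^bold>\<in> om \<Longrightarrow> app (tail n x) k = app x (add n k)" by auto
qed

lemma tail_inject:
  assumes "point x" "point y" "agree n x y" "tail n x = tail n y"
  shows "x = y"
proof (rule fun_eqI[OF assms(1,2)])
  fix m assume m: "m \<^bold>\<in> om"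
  show "app x m = app y m"
    using less_or_add[OF n m] assms(3) app_tail[OF assms(1)] app_tail[OF assms(2)] assms(4) by metis
qed

lemma
  assumes s: "point s" and z: "point z"
  shows point_join: "point (join n s z)"
    and agree_join: "agree n (join n s z) s"
    and tail_join: "tail n (join n s z) = z"
proof -
  let ?i = "\<lambda>m. the_set (\<lambda>k. k \<^bold>\<in> om \<and> m = add n k)"
  let ?G = "\<lambda>m. if m \<^bold>\<in> n then app s m else app z (?i m)"
  have i: "?i (add n k) = k" if "k \<^bold>\<in> om" for k
    by (rule the_set_equality) (use add_inject[OF n] that in auto)
  have d: "definable_term (\<lambda>e. ?G (e 0))" by (intro definable_intros)
  have G: "?G m \<^bold>\<in> two" if "m \<^bold>\<in> om" for m
    using less_or_add[OF n that] i app_mem[OF s] app_mem[OF z] that by auto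
  show point: "point (join n s z)" by (rule is_fun_lam[OF d G])
  have app: "app (join n s z) m = ?G m" if "m \<^bold>\<in> om" for m
    by (rule app_lam[OF d G]) (use that in auto)
  show "agree n (join n s z) s" using app mem_om_trans[OF n] by simp
  show "tail n (join n s z) = z"
  proof (rule fun_eqI[OF point_tail[OF point] z])
    fix k assume k: "k \<^bold>\<in> om"
    then show "app (tail n (join n s z)) k = app z k"
      using app_tail[OF point] app[OF add_om[OF n k]] i not_add_mem[OF n k] by simp
  qed
qed

end

section \<open>The position of the first one\<close>

lemma lead_exists:
  assumes "point x" "k \<^bold>\<in> om" "app x k \<noteq> emp"
  shows "\<exists>n. n \<^bold>\<in> om \<and> lead n x"
proof -
  let ?S = "compr om (\<lambda>k. app x k \<noteq> emp)"
  have S: "k \<^bold>\<in> ?S \<longleftrightarrow> k \<^bold>\<in> om \<and> app x k \<noteq> emp" for k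
    by (rule mem_compr) (intro definable_intros)
  \<comment> \<open>Foundation yields a membership-minimal element, that is, the least position with
    a nonzero value.\<close>
  obtain n where "n \<^bold>\<in> ?S" "\<not> (\<exists>k. k \<^bold>\<in> n \<and> k \<^bold>\<in> ?S)"
    using foundation[of ?S] assms(2,3) S by blast
  then show ?thesis unfolding S using point_cases[OF assms(1)] mem_om_trans by blast
qed

text \<open>At the smaller of two different positions the value would be both zero and one.\<close>

lemma lead_unique:
  assumes "m \<^bold>\<in> om" "n \<^bold>\<in> om" "lead m x" "lead n x"
  shows "m = n"
  using om_linear[OF assms(1,2)] assms(3,4) by auto

lemma lead_agree:
  assumes "n \<^bold>\<in> om" "n \<^bold>\<in> m" "m \<^bold>\<in> om" "lead n x" "agree m y x"
  shows "lead n y"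
  using assms om_mem_trans[OF assms(3,2)] by auto

lemma lead_tail_inject:
  assumes "n \<^bold>\<in> om" "point x" "point y" "lead n x" "lead n y" "tail (suc n) x = tail (suc n) y"
  shows "x = y"
  by (rule tail_inject[OF suc_om[OF assms(1)] assms(2,3) _ assms(6)]) (use assms(4,5) in auto)

lemma lead_point_exists:
  assumes n: "n \<^bold>\<in> om" and z: "point z"
  shows "\<exists>x. point x \<and> lead n x \<and> tail (suc n) x = z"
proof -
  let ?G = "\<lambda>k. if k = n then one else emp"
  have d: "definable_term (\<lambda>e. ?G (e 0))" by (intro definable_intros)
  have G: "?G k \<^bold>\<in> two" for k using mem_two by auto
  let ?s = "lam om ?G" and ?x = "join (suc n) (lam om ?G) z"
  have s: "point ?s" by (rule is_fun_lam[OF d G])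
  have app: "k \<^bold>\<in> om \<Longrightarrow> app ?s k = ?G k" for k by (rule app_lam[OF d G])
  have "k \<^bold>\<in> n \<Longrightarrow> k \<noteq> n" for k using not_mem_self by blast
  then have "lead n ?x"
    using agree_join[OF suc_om[OF n] s z] app n mem_om_trans[OF n] by simp
  then show ?thesis
    using point_join[OF suc_om[OF n] s z] tail_join[OF suc_om[OF n] s z] by blast
qed

section \<open>Open and closed sets through agreement on initial segments\<close>

lemma fin_seq_iff: "fin_seq s \<longleftrightarrow> (\<exists>n. n \<^bold>\<in> om \<and> is_fun s n two)"
  unfolding fin_seq_def is_omega_iff is_two_iff by blast

lemma fin_seq_subset_iff:
  assumes "n \<^bold>\<in> om" "is_fun s n two" "point x"
  shows "s \<^bold>\<subseteq> x \<longleftrightarrow> agree n s x"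
proof
  assume "s \<^bold>\<subseteq> x"
  then show "agree n s x"
    using pair_mem_fun[OF assms(2)] pair_mem_fun[OF assms(3)] unfolding subset_def by metis
next
  assume ag: "agree n s x"
  show "s \<^bold>\<subseteq> x" unfolding subset_def
  proof (intro allI impI)
    fix p assume p: "p \<^bold>\<in> s"
    then obtain a b where ab: "p = pair a b" using assms(2) unfolding is_fun_iff by blast
    then have "a \<^bold>\<in> n" "b = app s a" using p pair_mem_fun[OF assms(2)] by auto
    then show "p \<^bold>\<in> x" using ab ag pair_mem_fun[OF assms(3)] mem_om_trans[OF assms(1)] by simp
  qed
qed

lemma open_setD:
  assumes "open_set U" "x \<^bold>\<in> U"
  shows "point x" "\<exists>n. n \<^bold>\<in> om \<and> (\<forall>y. point y \<and> agree n x y \<longrightarrow> y \<^bold>\<in> U)"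
proof -
  obtain N s where N: "x \<^bold>\<in> N" "\<And>y. y \<^bold>\<in> N \<Longrightarrow> y \<^bold>\<in> U" "fin_seq s" "is_cylinder N s"
    using assms unfolding open_set_def is_Union_def by blast
  then have mem: "y \<^bold>\<in> N \<longleftrightarrow> point y \<and> s \<^bold>\<subseteq> y" for y
    unfolding is_cylinder_def cantor_point_iff by blast
  show x: "point x" using N(1) mem by blast
  obtain n where n: "n \<^bold>\<in> om" "is_fun s n two" using N(3) unfolding fin_seq_iff by blast
  have "agree n s x" using N(1) mem fin_seq_subset_iff[OF n x] by blast
  then have "y \<^bold>\<in> U" if "point y" "agree n x y" for y
    using that fin_seq_subset_iff[OF n] mem N(2) by auto
  then show "\<exists>n. n \<^bold>\<in> om \<and> (\<forall>y. point y \<and> agree n x y \<longrightarrow> y \<^bold>\<in> U)" using n(1) by blast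
qed

text \<open>The restriction of \<open>x\<close> to \<open>n\<close> is the finite sequence naming
  the basic neighbourhood of depth \<open>n\<close> around \<open>x\<close>.\<close>

lemma lam_agree:
  assumes "n \<^bold>\<in> om" "point x"
  shows "is_fun (lam n (app x)) n two" "agree n (lam n (app x)) x"
proof -
  have d: "definable_term (\<lambda>e. app x (e 0))" by (intro definable_intros)
  have "app x k \<^bold>\<in> two" if "k \<^bold>\<in> n" for k
    using app_mem[OF assms(2) mem_om_trans[OF assms(1) that]] .
  from is_fun_lam[OF d this] app_lam[OF d this]
  show "is_fun (lam n (app x)) n two" "agree n (lam n (app x)) x" by auto
qed

end

locale ZF_cantor = ZF_model +
  fixes K
  assumes is_cantor: "is_cantor K"
begin

lemma mem_K: "x \<^bold>\<in> K \<longleftrightarrow> point x"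
  using is_cantor unfolding is_cantor_def cantor_point_iff by blast

lemma mem_compr_K: "definable (\<lambda>e. P (e 0)) \<Longrightarrow> x \<^bold>\<in> compr K P \<longleftrightarrow> point x \<and> P x"
  by (simp only: mem_compr mem_K)

lemma open_setI:
  assumes "\<And>x. x \<^bold>\<in> U \<Longrightarrow> point x"
    and "\<And>x. x \<^bold>\<in> U \<Longrightarrow> \<exists>n. n \<^bold>\<in> om \<and> (\<forall>y. point y \<and> agree n x y \<longrightarrow> y \<^bold>\<in> U)"
  shows "open_set U"
proof -
  obtain W where W: "\<And>X. X \<^bold>\<in> W \<longleftrightarrow> X \<^bold>\<subseteq> K" using powerset[of K] by blast
  \<comment> \<open>The family consists of all cylinders inside \<open>U\<close>, so no
    neighbourhoods are chosen. Finite sequences and cylinders are written out to make the condition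
    visibly definable.\<close>
  let ?P = "\<lambda>N. (\<exists>s n. n \<^bold>\<in> om \<and> is_fun s n two \<and>
    (\<forall>x. x \<^bold>\<in> N \<longleftrightarrow> point x \<and> (\<forall>p. p \<^bold>\<in> s \<longrightarrow> p \<^bold>\<in> x))) \<and> (\<forall>x. x \<^bold>\<in> N \<longrightarrow> x \<^bold>\<in> U)"
  have F: "N \<^bold>\<in> compr W ?P \<longleftrightarrow> N \<^bold>\<in> W \<and> ?P N" for N
    by (rule mem_compr) (intro definable_intros)
  have "\<exists>s. fin_seq s \<and> is_cylinder N s" if "N \<^bold>\<in> compr W ?P" for N
    using that unfolding F fin_seq_iff is_cylinder_def cantor_point_iff subset_def by blast
  moreover have "\<exists>N. N \<^bold>\<in> compr W ?P \<and> x \<^bold>\<in> N" if x: "x \<^bold>\<in> U" for x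
  proof -
    obtain n where n: "n \<^bold>\<in> om" "\<And>y. point y \<Longrightarrow> agree n x y \<Longrightarrow> y \<^bold>\<in> U"
      using assms(2)[OF x] by blast
    note s = lam_agree[OF n(1) assms(1)[OF x]]
    let ?s = "lam n (app x)" and ?N = "compr K (\<lambda>y. \<forall>p. p \<^bold>\<in> lam n (app x) \<longrightarrow> p \<^bold>\<in> y)"
    have N: "y \<^bold>\<in> ?N \<longleftrightarrow> point y \<and> (\<forall>p. p \<^bold>\<in> ?s \<longrightarrow> p \<^bold>\<in> y)" for y
      by (rule mem_compr_K) (intro definable_intros)
    have sub: "(\<forall>p. p \<^bold>\<in> ?s \<longrightarrow> p \<^bold>\<in> y) \<longleftrightarrow> agree n x y" if "point y" for y
      using fin_seq_subset_iff[OF n(1) s(1) that] s(2) unfolding subset_def by auto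
    have "x \<^bold>\<in> ?N" unfolding N using sub assms(1)[OF x] by auto
    moreover have "?N \<^bold>\<in> W" unfolding W subset_def N mem_K by blast
    moreover have "y \<^bold>\<in> U" if "y \<^bold>\<in> ?N" for y
      using that unfolding N using sub n(2) by blast
    moreover have "\<exists>s m. m \<^bold>\<in> om \<and> is_fun s m two \<and>
        (\<forall>y. y \<^bold>\<in> ?N \<longleftrightarrow> point y \<and> (\<forall>p. p \<^bold>\<in> s \<longrightarrow> p \<^bold>\<in> y))"
      by (rule exI[of _ ?s], rule exI[of _ n]) (intro conjI allI n(1) s(1) N)
    ultimately have "?N \<^bold>\<in> compr W ?P \<and> x \<^bold>\<in> ?N" unfolding F by simp
    then show ?thesis by (rule exI)
  qed
  moreover have "x \<^bold>\<in> U" if "N \<^bold>\<in> compr W ?P" "x \<^bold>\<in> N" for N x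
    using that unfolding F by blast
  ultimately show ?thesis unfolding open_set_def is_Union_def by blast
qed

lemma closed_setI:
  assumes "\<And>x. x \<^bold>\<in> C \<Longrightarrow> point x"
    and "\<And>x. point x \<Longrightarrow> \<not> x \<^bold>\<in> C \<Longrightarrow> \<exists>n. n \<^bold>\<in> om \<and> (\<forall>y. point y \<and> agree n x y \<longrightarrow> \<not> y \<^bold>\<in> C)"
  shows "closed_set C"
proof -
  have U: "x \<^bold>\<in> compr K (\<lambda>x. \<not> x \<^bold>\<in> C) \<longleftrightarrow> point x \<and> \<not> x \<^bold>\<in> C" for x
    by (rule mem_compr_K) (intro definable_intros)
  have "open_set (compr K (\<lambda>x. \<not> x \<^bold>\<in> C))"
  proof (rule open_setI)
    fix x assume "x \<^bold>\<in> compr K (\<lambda>x. \<not> x \<^bold>\<in> C)"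
    then obtain n where "n \<^bold>\<in> om" "\<forall>y. point y \<and> agree n x y \<longrightarrow> \<not> y \<^bold>\<in> C"
      using assms(2)[of x] unfolding U by blast
    then show "\<exists>n. n \<^bold>\<in> om \<and> (\<forall>y. point y \<and> agree n x y \<longrightarrow> y \<^bold>\<in> compr K (\<lambda>x. \<not> x \<^bold>\<in> C))"
      unfolding U by (intro exI[of _ n]) simp
  qed (simp only: U)
  then show ?thesis
    unfolding closed_set_def cantor_point_iff using U assms(1) by blast
qed

lemma zero_point: "point (lam om (\<lambda>_. emp))" and one_point: "point (lam om (\<lambda>_. one))"
  by (rule is_fun_lam, intro definable_intros, simp add: mem_two)+

text \<open>Diagonal argument: \<open>?G\<close> flips the \<open>n\<close>-th value of the
  \<open>n\<close>-th listed point.\<close>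

lemma uncountable_K: "\<not> is_countable K"
proof
  assume "is_countable K"
  then obtain f where f: "is_fun f om K" "\<And>x. x \<^bold>\<in> K \<Longrightarrow> \<exists>n. n \<^bold>\<in> om \<and> x = app f n"
    using zero_point mem_K not_mem_emp unfolding is_countable_iff by metis
  let ?G = "\<lambda>n. if app (app f n) n = emp then one else emp"
  have d: "definable_term (\<lambda>e. ?G (e 0))" by (intro definable_intros)
  have G: "?G n \<^bold>\<in> two" for n using mem_two by auto
  obtain n where n: "n \<^bold>\<in> om" "lam om ?G = app f n"
    using f(2) is_fun_lam[OF d G] unfolding mem_K by blast
  have "app (app f n) n = ?G n"
    using app_lam[OF d G n(1)] unfolding n(2) .
  then show False by (auto split: if_splits)
qed

end

section \<open>The uncountable set without perfect subsets\<close>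

text \<open>\<open>perfect_set\<close> quantifies over its own copy of the Cantor set; this
  identifies it with the fixed \<open>K\<close>.\<close>

lemma (in ZF_model) is_cantor_unique: "is_cantor K \<Longrightarrow> is_cantor K' \<Longrightarrow> K = K'"
  unfolding is_cantor_def by (rule set_eqI) simp

text \<open>\<open>app f n\<close> is the \<open>n\<close>-th piece of the cover. Only the pieces
  are listed by \<open>f\<close>; no enumerations of them are selected simultaneously.\<close>

locale countable_cover = ZF_cantor +
  fixes f
  assumes countable: "n \<^bold>\<in> om \<Longrightarrow> is_countable (app f n)"
    and cover: "x \<^bold>\<in> K \<longleftrightarrow> (\<exists>n. n \<^bold>\<in> om \<and> x \<^bold>\<in> app f n)"
begin

section \<open>The counterexample and its closed and F-sigma constituents\<close>

abbreviation fiber :: "'a \<Rightarrow> 'a \<Rightarrow> 'a" where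
  "fiber n z \<equiv> compr K (\<lambda>x. lead n x \<longrightarrow> tail (suc n) x = z)"

abbreviation block :: "'a \<Rightarrow> 'a" where
  "block n \<equiv> compr K (\<lambda>x. lead n x \<longrightarrow> tail (suc n) x \<^bold>\<in> app f n)"

text \<open>The set \<open>B\<close> of the introductory idea. The zero sequence has no lead, so it
  satisfies the condition vacuously.\<close>

definition wedge :: 'a where
  "wedge = compr K (\<lambda>x. \<forall>n. n \<^bold>\<in> om \<longrightarrow> lead n x \<longrightarrow> tail (suc n) x \<^bold>\<in> app f n)"

lemma mem_wedge:
  "x \<^bold>\<in> wedge \<longleftrightarrow> point x \<and> (\<forall>n. n \<^bold>\<in> om \<longrightarrow> lead n x \<longrightarrow> tail (suc n) x \<^bold>\<in> app f n)"
  unfolding wedge_def by (rule mem_compr_K) (intro definable_intros)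

lemma mem_block: "x \<^bold>\<in> block n \<longleftrightarrow> point x \<and> (lead n x \<longrightarrow> tail (suc n) x \<^bold>\<in> app f n)"
  by (rule mem_compr_K) (intro definable_intros)

lemma mem_fiber: "x \<^bold>\<in> fiber n z \<longleftrightarrow> point x \<and> (lead n x \<longrightarrow> tail (suc n) x = z)"
  by (rule mem_compr_K) (intro definable_intros)

lemma mem_compr_lead: "x \<^bold>\<in> compr K (lead n) \<longleftrightarrow> point x \<and> lead n x"
  by (rule mem_compr_K) (intro definable_intros)

text \<open>A point outside has lead \<open>n\<close> and a tail differing from \<open>z\<close> at
  some \<open>k\<close>. Both facts are decided by the values up to position
  \<open>add (suc n) k\<close>, hence are shared by a whole neighbourhood.\<close>

lemma closed_fiber:
  assumes n: "n \<^bold>\<in> om" and z: "point z"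
  shows "closed_set (fiber n z)"
proof (rule closed_setI)
  fix x assume x: "point x" "\<not> x \<^bold>\<in> fiber n z"
  then have lead: "lead n x" and "tail (suc n) x \<noteq> z" unfolding mem_fiber by auto
  then obtain k where k: "k \<^bold>\<in> om" "app (tail (suc n) x) k \<noteq> app z k"
    using fun_eqI[OF point_tail[OF suc_om[OF n] x(1)] z] by blast
  let ?j = "add (suc n) k"
  have j: "?j \<^bold>\<in> om" "n \<^bold>\<in> ?j"
    using add_om[OF suc_om[OF n] k(1)] mem_add_trans[OF suc_om[OF n] k(1), of n] by auto
  have "\<not> y \<^bold>\<in> fiber n z" if y: "point y" "agree (suc ?j) x y" for y
  proof -
    have "lead n y" using lead_agree[OF n, of "suc ?j" x y] j lead y(2) by simp
    moreover have "app (tail (suc n) y) k \<noteq> app z k"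
      using k y(2) app_tail[OF suc_om[OF n]] x(1) y(1) by simp
    ultimately show ?thesis unfolding mem_fiber by auto
  qed
  then show "\<exists>m. m \<^bold>\<in> om \<and> (\<forall>y. point y \<and> agree m x y \<longrightarrow> \<not> y \<^bold>\<in> fiber n z)"
    by (intro exI[of _ "suc ?j"]) (use j(1) in simp)
qed (simp only: mem_fiber)

lemma lead_stable:
  assumes n: "n \<^bold>\<in> om" and "lead n x" "agree (suc n) x y"
  shows "lead n y"
  using lead_agree[OF n, of "suc n" x y] assms by simp

lemma open_lead:
  assumes n: "n \<^bold>\<in> om"
  shows "open_set (compr K (lead n))"
proof (rule open_setI)
  fix x assume "x \<^bold>\<in> compr K (lead n)"
  then show "\<exists>m. m \<^bold>\<in> om \<and> (\<forall>y. point y \<and> agree m x y \<longrightarrow> y \<^bold>\<in> compr K (lead n))"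
    unfolding mem_compr_lead
    by (intro exI[of _ "suc n"] conjI allI impI suc_om n) (use lead_stable[OF n] in blast)+
qed (simp only: mem_compr_lead)

text \<open>With an empty piece the block is the complement of an open cylinder, whereas a union of
  fibers over the empty set would be empty.\<close>

lemma closed_block_empty:
  assumes n: "n \<^bold>\<in> om" and empty: "\<And>z. \<not> z \<^bold>\<in> app f n"
  shows "closed_set (block n)"
proof (rule closed_setI)
  fix x assume "\<not> x \<^bold>\<in> block n" "point x"
  then have "lead n x" unfolding mem_block by blast
  then show "\<exists>m. m \<^bold>\<in> om \<and> (\<forall>y. point y \<and> agree m x y \<longrightarrow> \<not> y \<^bold>\<in> block n)"
    unfolding mem_block using empty
    by (intro exI[of _ "suc n"] conjI allI impI suc_om n) (use lead_stable[OF n] in blast)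
qed (simp only: mem_block)

lemma closed_imp_F_sigma:
  assumes "closed_set C"
  shows "F_sigma C"
proof -
  have mem: "X \<^bold>\<in> upair C C \<longleftrightarrow> X = C" for X by (simp add: mem_upair)
  have "is_countable (upair C C)"
    by (rule countableI[where G = "\<lambda>_. C"]) (intro definable_intros, use mem emp_om in blast)
  then show ?thesis
    unfolding F_sigma_def is_Union_def using mem assms by metis
qed

lemma F_sigma_block:
  assumes n: "n \<^bold>\<in> om"
  shows "F_sigma (block n)"
proof (cases "\<exists>z. z \<^bold>\<in> app f n")
  case True
  have d: "definable_term (\<lambda>e. fiber n (e 0))" by (intro definable_intros)
  let ?F = "img (app f n) (fiber n)"
  have mem: "C \<^bold>\<in> ?F \<longleftrightarrow> (\<exists>z. z \<^bold>\<in> app f n \<and> C = fiber n z)" for C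
    by (rule mem_img[OF d])
  have "is_countable ?F"
    by (rule countable_image[OF countable[OF n] d]) (simp only: mem)
  moreover have "closed_set C" if "C \<^bold>\<in> ?F" for C
    using that closed_fiber[OF n] cover mem_K n unfolding mem by blast
  moreover have "x \<^bold>\<in> block n \<longleftrightarrow> (\<exists>C. C \<^bold>\<in> ?F \<and> x \<^bold>\<in> C)" for x
  proof -
    have "(\<exists>C. C \<^bold>\<in> ?F \<and> x \<^bold>\<in> C) \<longleftrightarrow> (\<exists>z. z \<^bold>\<in> app f n \<and> x \<^bold>\<in> fiber n z)"
      unfolding mem by blast
    \<comment> \<open>A point without lead \<open>n\<close> lies in every fiber; \<open>True\<close>
      provides one.\<close>
    then show ?thesis using True unfolding mem_block mem_fiber by blast
  qed
  ultimately show ?thesis unfolding F_sigma_def is_Union_def by blast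
next
  case False
  then show ?thesis using closed_imp_F_sigma closed_block_empty[OF n] by blast
qed

text \<open>The blocks are enumerated by \<open>n\<close> itself, and each is F-sigma by a separate
  existence statement, so no countable choice enters.\<close>

lemma F_sigma_delta_wedge: "F_sigma_delta wedge"
proof -
  have d: "definable_term (\<lambda>e. block (e 0))" by (intro definable_intros)
  let ?F = "img om block"
  have mem: "A \<^bold>\<in> ?F \<longleftrightarrow> (\<exists>n. n \<^bold>\<in> om \<and> A = block n)" for A by (rule mem_img[OF d])
  have "is_countable ?F" by (rule countableI[OF d]) (simp only: mem)
  moreover have "F_sigma A" if "A \<^bold>\<in> ?F" for A using that F_sigma_block unfolding mem by blast
  moreover have "x \<^bold>\<in> wedge \<longleftrightarrow> point x \<and> (\<forall>A. A \<^bold>\<in> ?F \<longrightarrow> x \<^bold>\<in> A)" for x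
  proof -
    have "(\<forall>A. A \<^bold>\<in> ?F \<longrightarrow> x \<^bold>\<in> A) \<longleftrightarrow> (\<forall>n. n \<^bold>\<in> om \<longrightarrow> x \<^bold>\<in> block n)"
      unfolding mem by blast
    then show ?thesis unfolding mem_wedge mem_block by blast
  qed
  ultimately show ?thesis unfolding F_sigma_delta_def cantor_point_iff by blast
qed

text \<open>Read \<open>n\<close> off the point as the position of its first one and delete
  \<open>0^n 1\<close>: every element of \<open>K\<close> arises in this way, so an enumeration of
  \<open>wedge\<close> would give one of \<open>K\<close>.\<close>

lemma uncountable_wedge: "\<not> is_countable wedge"
proof
  assume countable: "is_countable wedge"
  let ?n = "\<lambda>x. the_set (\<lambda>n. n \<^bold>\<in> om \<and> lead n x)"
  have "is_countable K"
  proof (rule countable_image[OF countable])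
    show "definable_term (\<lambda>e. tail (suc (?n (e 0))) (e 0))" by (intro definable_intros)
    fix z assume z: "z \<^bold>\<in> K"
    then obtain n where n: "n \<^bold>\<in> om" "z \<^bold>\<in> app f n" using cover by blast
    obtain x where x: "point x" "lead n x" "tail (suc n) x = z"
      using lead_point_exists[OF n(1)] z mem_K by blast
    have unique: "m = n" if "m \<^bold>\<in> om \<and> lead m x" for m
      using lead_unique n(1) x(2) that by blast
    have "?n x = n" by (rule the_set_equality) (use n(1) x(2) unique in blast)+
    moreover have "x \<^bold>\<in> wedge" unfolding mem_wedge using x n(2) unique by blast
    ultimately show "\<exists>x. x \<^bold>\<in> wedge \<and> z = tail (suc (?n x)) x" using x(3) by auto
  qed
  then show False using uncountable_K by blast
qed

section \<open>Absence of perfect subsets\<close>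

lemma rel_open_cantor_iff: "rel_open U K \<longleftrightarrow> open_set U"
proof
  assume "rel_open U K"
  then obtain W where W: "open_set W" "\<And>x. x \<^bold>\<in> U \<longleftrightarrow> x \<^bold>\<in> W \<and> x \<^bold>\<in> K"
    unfolding rel_open_def by blast
  then have "U = W" using open_setD(1) mem_K by (intro set_eqI) blast
  then show "open_set U" using W(1) by simp
next
  assume "open_set U"
  then show "rel_open U K" unfolding rel_open_def using open_setD(1) mem_K by blast
qed

lemma no_perfect_subset:
  assumes "perfect_set P" "P \<^bold>\<subseteq> wedge"
  shows False
proof -
  obtain h g where h: "is_continuous h P K" and g: "is_continuous g K P"
    and inverse: "\<And>x y. maps_to h x y \<longleftrightarrow> maps_to g y x"
    using assms(1) is_cantor_unique[OF is_cantor]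
    unfolding perfect_set_def homeomorphic_sets_def by blast
  have g_fun: "is_fun g K P" and h_fun: "is_fun h P K"
    using g h unfolding is_continuous_def by auto
  have inj: "y = y'" if "y \<^bold>\<in> K" "y' \<^bold>\<in> K" "app g y = app g y'" for y y'
    using that inverse pair_mem_fun[OF g_fun] pair_mem_fun[OF h_fun] unfolding maps_to_iff by metis
  have g_wedge: "app g y \<^bold>\<in> wedge" if "y \<^bold>\<in> K" for y
    using app_mem[OF g_fun that] assms(2) unfolding subset_def by blast
  then have g_point: "point (app g y)" if "y \<^bold>\<in> K" for y
    using that unfolding mem_wedge by blast
  \<comment> \<open>Some value of \<open>g\<close> is nonzero, since otherwise the two constant
    sequences would have the same image under the injective \<open>g\<close>.\<close>
  have "\<exists>c k. c \<^bold>\<in> K \<and> k \<^bold>\<in> om \<and> app (app g c) k \<noteq> emp"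
  proof (rule ccontr)
    let ?a = "lam om (\<lambda>_. emp)" and ?b = "lam om (\<lambda>_. one)"
    assume "\<not> ?thesis"
    then have zero: "app (app g y) k = emp" if "y \<^bold>\<in> K" "k \<^bold>\<in> om" for y k
      using that by blast
    have ab: "?a \<^bold>\<in> K" "?b \<^bold>\<in> K" using zero_point one_point mem_K by auto
    have "app g ?a = app g ?b"
      by (rule fun_eqI[OF g_point[OF ab(1)] g_point[OF ab(2)]]) (simp add: zero ab)
    then have "?a = ?b" using inj ab by blast
    moreover have "app ?a emp = emp"
      by (rule app_lam[where B = two]) (intro definable_intros, simp_all add: mem_two)
    moreover have "app ?b emp = one"
      by (rule app_lam[where B = two]) (intro definable_intros, simp_all add: mem_two)
    ultimately show False by simp
  qed
  then obtain c k where c: "c \<^bold>\<in> K" "k \<^bold>\<in> om" "app (app g c) k \<noteq> emp" by blast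
  then obtain n where n: "n \<^bold>\<in> om" "lead n (app g c)"
    using lead_exists[OF g_point[OF c(1)]] by blast
  \<comment> \<open>The part of \<open>P\<close> in the cylinder of \<open>0^n 1\<close> is
    relatively open; its preimage \<open>U\<close> under \<open>g\<close> is an open set containing
    \<open>c\<close>.\<close>
  let ?V = "compr P (lead n)"
  have V: "x \<^bold>\<in> ?V \<longleftrightarrow> x \<^bold>\<in> P \<and> lead n x" for x
    by (rule mem_compr) (intro definable_intros)
  have "point x" if "x \<^bold>\<in> P" for x
    using that assms(2) unfolding subset_def mem_wedge by blast
  then have "rel_open ?V P"
    unfolding rel_open_def
    by (intro exI[of _ "compr K (lead n)"]) (use open_lead[OF n(1)] V mem_compr_lead in blast)
  then obtain U where "rel_open U K" and U: "\<And>y. y \<^bold>\<in> U \<longleftrightarrow> y \<^bold>\<in> K \<and> (\<exists>x. x \<^bold>\<in> ?V \<and> maps_to g y x)"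
    using g unfolding is_continuous_def by blast
  then have "open_set U" by (simp only: rel_open_cantor_iff)
  have mem_U: "y \<^bold>\<in> U \<longleftrightarrow> y \<^bold>\<in> K \<and> lead n (app g y)" for y
    unfolding U V maps_to_iff pair_mem_fun[OF g_fun] using app_mem[OF g_fun] by auto
  \<comment> \<open>\<open>U\<close> contains all points agreeing with \<open>c\<close> below
    \<open>m\<close>, which \<open>join m c\<close> parametrizes by the whole Cantor space.\<close>
  then obtain m where m: "m \<^bold>\<in> om" "\<And>y. point y \<Longrightarrow> agree m c y \<Longrightarrow> y \<^bold>\<in> U"
    using open_setD(2)[OF \<open>open_set U\<close>, of c] c(1) n(2) by blast
  \<comment> \<open>The inverse of the map from \<open>U\<close> into \<open>app f n\<close> sending
    \<open>y\<close> to the tail of \<open>app g y\<close>. That map is injective since lead and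
    tail determine \<open>app g y\<close>, which determines \<open>y\<close>. Then
    \<open>tail m\<close> of this inverse covers \<open>K\<close> by a countable set.\<close>
  let ?y = "\<lambda>z. the_set (\<lambda>y. y \<^bold>\<in> U \<and> tail (suc n) (app g y) = z)"
  have "is_countable K"
  proof (rule countable_image[OF countable[OF n(1)]])
    show "definable_term (\<lambda>e. tail m (?y (e 0)))" by (intro definable_intros)
    fix w assume "w \<^bold>\<in> K"
    then have w: "point w" and cp: "point c" using c(1) mem_K by auto
    let ?j = "join m c w"
    let ?z = "tail (suc n) (app g ?j)"
    have j: "?j \<^bold>\<in> U"
      using m(2) point_join[OF m(1) cp w] agree_join[OF m(1) cp w] by simp
    have y: "?y ?z = ?j"
    proof (rule the_set_equality)
      show "?j \<^bold>\<in> U \<and> tail (suc n) (app g ?j) = ?z" using j by blast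
      show "y = ?j" if "y \<^bold>\<in> U \<and> tail (suc n) (app g y) = ?z" for y
        using that j lead_tail_inject[OF n(1) g_point g_point] inj unfolding mem_U by blast
    qed
    have z: "?z \<^bold>\<in> app f n"
      using g_wedge j n(1) unfolding mem_U mem_wedge by blast
    have "w = tail m (?y ?z)" by (simp only: y tail_join[OF m(1) cp w])
    with z show "\<exists>z. z \<^bold>\<in> app f n \<and> w = tail m (?y z)" by (intro exI[of _ ?z] conjI)
  qed
  then show False using uncountable_K by blast
qed

end

section \<open>From a countable family of pieces to an enumerated cover\<close>

theorem theorem1p3:
  fixes mem :: "'a \<Rightarrow> 'a \<Rightarrow> bool"
  assumes "ZF_model mem"
    and "\<exists>K F. set_structure.is_cantor mem K \<and> set_structure.is_countable mem F \<and>
           (\<forall>A. mem A F \<longrightarrow> set_structure.is_countable mem A) \<and> set_structure.is_Union mem K F"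
  shows "\<exists>B. set_structure.F_sigma_delta mem B \<and> \<not> set_structure.is_countable mem B \<and>
           \<not> (\<exists>P. set_structure.perfect_set mem P \<and> set_structure.subset mem P B)"
proof -
  interpret ZF_model mem by (rule assms(1))
  obtain K F where K: "is_cantor K" and F: "is_countable F" "\<And>A. mem A F \<Longrightarrow> is_countable A"
    and U: "is_Union K F"
    using assms(2) by blast
  interpret ZF_cantor mem K by unfold_locales (rule K)
  \<comment> \<open>The zero sequence lies in some member of \<open>F\<close>, which excludes the
    empty case of countability and leaves an enumeration \<open>f\<close>.\<close>
  have "F \<noteq> emp" using U zero_point mem_K unfolding is_Union_def by auto
  then obtain f where f: "is_fun f om F" "\<And>A. mem A F \<Longrightarrow> \<exists>n. mem n om \<and> A = app f n"
    using F(1) unfolding is_countable_iff by blast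
  interpret countable_cover mem K f
  proof
    show "is_countable (app f n)" if "mem n om" for n
      using F(2) app_mem[OF f(1) that] by blast
    show "mem x K \<longleftrightarrow> (\<exists>n. mem n om \<and> mem x (app f n))" for x
      using U f(2) app_mem[OF f(1)] unfolding is_Union_def by metis
  qed
  show ?thesis
    using F_sigma_delta_wedge uncountable_wedge no_perfect_subset by blast
qed

end
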